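(* For every integer $n\ge 0$: (i) for every positive integer $\ell$, $$\overline{R}_\ell^{\ast}(n)+\sum_{\nu=1}^{\infty}\overline{R}_\ell^{\ast}(n-\ell\nu)\,p(\nu)=\overline{p}(n);$$ (ii) $\overline{R}_2^{\ast}(n)=D_2(n)$, where $D_2(n)$ is the number of partitions of $n$ into distinct parts such that each part has two copies (i.e. each positive integer is available as a part in two distinguishable copies, and each copy is used at most once).
   Context: An overpartition of a nonnegative integer $n$ is a partition of $n$ in which the first occurrence of each part size may be overlined; $\overline{p}(n)$ denotes the number of overpartitions of $n$. For a positive integer $\ell$, $\overline{R}_\ell^{\ast}(n)$ denotes the number of overpartitions of $n$ in which the non-overlined parts are $\ell$-regular, i.e. no non-overlined part is divisible by $\ell$ (overlined parts are unrestricted); $\overline{R}_\ell^{\ast}(m)=0$ for $m<0$. The partition function $p(m)$ counts the partitions of $m$, with $p(0)=1$. With $f_h:=\prod_{m\ge 1}(1-q^{hm})$, the generating functions are $\sum_{n\ge 0}\overline{R}_\ell^{\ast}(n)q^n=\frac{f_2f_\ell}{f_1^2}$ and $\sum_{n\ge 0}\overline{p}(n)q^n=\frac{f_2}{f_1^2}$. The numbers $D_2(n)$ have generating function $\sum_{n\ge 0}D_2(n)q^n=\prod_{m\ge 1}(1+q^m)^2$. *)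

theory Defs
  imports "HOL-Library.Multiset" "HOL-Analysis.Infinite_Sum"
begin

definition partitions :: "nat \<Rightarrow> nat multiset set" where
  "partitions n = {M. 0 \<notin># M \<and> sum_mset M = n}"

definition num_partitions :: "nat \<Rightarrow> nat" where
  "num_partitions n = card (partitions n)"

(* A pair (M, S) stands for the overpartition whose underlying partition is M (overlined and
   non-overlined parts together) and in which the first occurrence of the part size k is
   overlined exactly if k is in S. *)
definition overpartitions :: "nat \<Rightarrow> (nat multiset \<times> nat set) set" where
  "overpartitions n = {(M, S). M \<in> partitions n \<and> S \<subseteq> set_mset M}"

definition num_overpartitions :: "nat \<Rightarrow> nat" where
  "num_overpartitions n = card (overpartitions n)"

(* One copy of each element of S is overlined, so these are the remaining parts of M. *)
definition non_overlined :: "nat multiset \<times> nat set \<Rightarrow> nat multiset" where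
  "non_overlined = (\<lambda>(M, S). M - mset_set S)"

definition R_star :: "nat \<Rightarrow> int \<Rightarrow> nat" where
  "R_star l n =
     (if n < 0 then 0
      else card {P \<in> overpartitions (nat n). \<forall>k \<in># non_overlined P. \<not> l dvd k})"

(* (k, False) and (k, True) are the two copies of the positive integer k. *)
definition two_copy_distinct_partitions :: "nat \<Rightarrow> (nat \<times> bool) set set" where
  "two_copy_distinct_partitions n =
     {A. finite A \<and> (\<forall>x \<in> A. 0 < fst x) \<and> (\<Sum>x \<in> A. fst x) = n}"

definition D2 :: "nat \<Rightarrow> nat" where
  "D2 n = card (two_copy_distinct_partitions n)"

end

theory Submission
  imports Defs
begin

text \<open>
  An overpartition amounts to a pair of a multiset (its non-overlined parts) and a finite set
  (its overlined parts), both of positive integers. Both claims come from splitting the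
  multiset uniquely as \<open>N + h Q\<close> with \<open>N\<close> restricted and \<open>Q\<close> arbitrary, where \<open>h\<close> multiplies
  the sum of a multiset by a constant \<open>l\<close>; counting by the sum of \<open>Q\<close> then gives a convolution
  with the partition function (\<open>convolution_with_partitions\<close>).

  For (i), collect the non-overlined parts divisible by \<open>l\<close> and divide them by \<open>l\<close>
  (\<open>bij_multiples\<close>).

  For (ii), halve the multiplicities instead, leaving a multiplicity-free multiset
  (\<open>bij_doubling\<close>). A multiplicity-free multiset together with a finite set is the same thing as
  a two-copy distinct partition, so \<open>D2\<close> satisfies the same convolution identity as the numbers
  of (i) for \<open>l = 2\<close>. Since the partition function is 1 at 0, the identity determines the
  sequence recursively, and the two sequences agree. In generating functions: both are
  \<open>f\<^sub>2\<close> times the series of overpartitions.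
\<close>

section \<open>Overpartitions as pairs of a multiset and a set\<close>

text \<open>
  \<open>N\<close> holds the non-overlined and \<open>S\<close> the overlined parts, so a condition on the non-overlined
  parts is just a choice of \<open>\<N>\<close>. This separates what \<open>overpartitions\<close> keeps in one multiset.
\<close>

definition part_pairs :: "nat multiset set \<Rightarrow> nat \<Rightarrow> (nat multiset \<times> nat set) set" where
  "part_pairs \<N> n =
     {(N, S). N \<in> \<N> \<and> 0 \<notin># N \<and> finite S \<and> 0 \<notin> S \<and> sum_mset N + \<Sum>S = n}"

lemma bij_part_pairs_overpartitions:
  "bij_betw (\<lambda>(N, S). (N + mset_set S, S)) (part_pairs \<N> n)
     {P \<in> overpartitions n. non_overlined P \<in> \<N>}"
proof (rule bij_betw_byWitness[where f' = "\<lambda>(M, S). (M - mset_set S, S)"])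
  have sub: "mset_set S \<subseteq># M" "finite S" if "S \<subseteq> set_mset M" for M :: "nat multiset" and S
    using that subset_mset.order_trans[OF subset_imp_msubset_mset_set[OF that]
        mset_set_set_mset_msubset] by (auto intro: finite_subset)
  show "\<forall>a\<in>part_pairs \<N> n. (\<lambda>(M, S). (M - mset_set S, S)) ((\<lambda>(N, S). (N + mset_set S, S)) a) = a"
    by auto
  show "\<forall>a'\<in>{P \<in> overpartitions n. non_overlined P \<in> \<N>}.
          (\<lambda>(N, S). (N + mset_set S, S)) ((\<lambda>(M, S). (M - mset_set S, S)) a') = a'"
    using sub by (auto simp: overpartitions_def)
  show "(\<lambda>(N, S). (N + mset_set S, S)) ` part_pairs \<N> n
          \<subseteq> {P \<in> overpartitions n. non_overlined P \<in> \<N>}"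
    by (auto simp: part_pairs_def overpartitions_def partitions_def non_overlined_def
        sum_unfold_sum_mset)
  show "(\<lambda>(M, S). (M - mset_set S, S)) ` {P \<in> overpartitions n. non_overlined P \<in> \<N>}
          \<subseteq> part_pairs \<N> n"
  proof (clarsimp simp: part_pairs_def overpartitions_def partitions_def non_overlined_def)
    fix M :: "nat multiset" and S
    assume M: "0 \<notin># M" "S \<subseteq> set_mset M"
    have "sum_mset (M - mset_set S) + \<Sum>S = sum_mset (M - mset_set S + mset_set S)"
      by (simp add: sum_unfold_sum_mset)
    also have "\<dots> = sum_mset M"
      using sub[OF M(2)] by simp
    finally show "0 \<notin># M - mset_set S \<and> finite S \<and> 0 \<notin> S
        \<and> sum_mset (M - mset_set S) + \<Sum>S = sum_mset M"
      using M sub[OF M(2)] by (auto dest: in_diffD)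
  qed
qed

lemma card_part_pairs:
  "card (part_pairs \<N> n) = card {P \<in> overpartitions n. non_overlined P \<in> \<N>}"
  by (rule bij_betw_same_card[OF bij_part_pairs_overpartitions])

lemma finite_partitions: "finite (partitions n)"
proof -
  have "M \<in> mset ` {xs. set xs \<subseteq> {..n} \<and> length xs \<le> n}" if "M \<in> partitions n" for M
  proof -
    have M: "0 \<notin># M" "sum_mset M = n"
      using that by (simp_all add: partitions_def)
    have "size M \<le> sum_mset M"
      using M(1) by (induction M) auto
    moreover have "set_mset M \<subseteq> {..n}"
      using M(2) by (auto dest: multi_member_split)
    moreover obtain xs where "M = mset xs"
      by (metis ex_mset)
    ultimately show ?thesis
      using M(2) by (intro image_eqI[of _ _ xs]) auto
  qed
  then have "partitions n \<subseteq> mset ` {xs. set xs \<subseteq> {..n} \<and> length xs \<le> n}"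
    by blast
  then show ?thesis
    by (rule finite_subset) (intro finite_imageI finite_lists_length_le finite_atMost)
qed

lemma num_partitions_0: "num_partitions 0 = 1"
proof -
  have "partitions 0 = {{#}}"
    by (auto simp: partitions_def) (metis multiset_nonemptyE)
  then show ?thesis
    by (simp add: num_partitions_def)
qed

lemma finite_part_pairs: "finite (part_pairs \<N> n)"
proof -
  have "overpartitions n = (SIGMA M:partitions n. Pow (set_mset M))"
    by (auto simp: overpartitions_def)
  then have "finite (overpartitions n)"
    by (simp add: finite_partitions)
  then show ?thesis
    using bij_betw_finite[OF bij_part_pairs_overpartitions] by simp
qed

section \<open>Convolution with the partition function\<close>

lemma finite_multiples_le:
  fixes l n :: nat
  assumes "l > 0"
  shows "finite {\<nu>. l * \<nu> \<le> n}"
proof (rule finite_subset)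
  have "\<nu> \<le> l * \<nu>" for \<nu>
    using assms by simp
  then show "{\<nu>. l * \<nu> \<le> n} \<subseteq> {..n}"
    using le_trans by blast
qed simp

text \<open>
  The pair \<open>(N + h Q, S)\<close> determines \<open>N\<close>, \<open>S\<close> and \<open>Q\<close>; the summation index is the sum of \<open>Q\<close>.
  The condition on 0 makes \<open>Q\<close> a partition exactly if \<open>h Q\<close> is one.
\<close>

lemma convolution_with_partitions:
  assumes l: "l > 0"
    and bij: "bij_betw (\<lambda>(N, Q). N + h Q) (\<N> \<times> UNIV) UNIV"
    and sum_h: "\<And>Q. sum_mset (h Q) = l * sum_mset Q"
    and zero_h: "\<And>Q. 0 \<in># h Q \<longleftrightarrow> 0 \<in># Q"
  shows "(\<Sum>\<nu> | l * \<nu> \<le> n. card (part_pairs \<N> (n - l * \<nu>)) * num_partitions \<nu>)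
           = num_overpartitions n"
proof -
  let ?I = "{\<nu>. l * \<nu> \<le> n}"
  let ?D = "SIGMA \<nu>:?I. part_pairs \<N> (n - l * \<nu>) \<times> partitions \<nu>"
  let ?f = "\<lambda>(\<nu>, (N, S), Q). (N + h Q, S)"
  have unique: "N = N' \<and> Q = Q'"
    if "N + h Q = N' + h Q'" "N \<in> \<N>" "N' \<in> \<N>" for N N' Q Q'
    using inj_onD[OF bij_betw_imp_inj_on[OF bij], of "(N, Q)" "(N', Q')"] that by simp
  have "bij_betw ?f ?D (part_pairs UNIV n)"
    unfolding bij_betw_def
  proof (intro conjI subset_antisym subsetI)
    show "inj_on ?f ?D"
      by (auto simp: inj_on_def part_pairs_def partitions_def dest: unique)
  next
    fix P assume "P \<in> ?f ` ?D"
    then show "P \<in> part_pairs UNIV n"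
      by (auto simp: part_pairs_def partitions_def sum_h zero_h)
  next
    fix P assume P: "P \<in> part_pairs UNIV n"
    obtain M S where MS: "P = (M, S)"
      by (cases P)
    have "M \<in> (\<lambda>(N, Q). N + h Q) ` (\<N> \<times> UNIV)"
      using bij_betw_imp_surj_on[OF bij] by simp
    then obtain N Q where M: "M = N + h Q" and N: "N \<in> \<N>"
      by auto
    have "(sum_mset Q, (N, S), Q) \<in> ?D"
      using P N unfolding MS M by (auto simp: part_pairs_def partitions_def sum_h zero_h)
    then show "P \<in> ?f ` ?D"
      unfolding MS M by (rule rev_image_eqI) simp
  qed
  then have "card ?D = card (part_pairs UNIV n)"
    by (rule bij_betw_same_card)
  moreover have "card ?D = (\<Sum>\<nu>\<in>?I. card (part_pairs \<N> (n - l * \<nu>)) * num_partitions \<nu>)"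
    by (simp add: card_SigmaI finite_multiples_le[OF l] finite_part_pairs finite_partitions
        num_partitions_def card_cartesian_product)
  ultimately show ?thesis
    by (simp add: card_part_pairs num_overpartitions_def)
qed

text \<open>
  The term for \<open>\<nu> = 0\<close> is \<open>f n\<close>, and all other terms involve \<open>f\<close> only below \<open>n\<close>, so the
  convolution determines \<open>f\<close> recursively.
\<close>

lemma convolution_cancel:
  fixes f g p :: "nat \<Rightarrow> nat"
  assumes l: "l > 0" and p: "p 0 = 1"
    and eq: "\<And>n. (\<Sum>\<nu> | l * \<nu> \<le> n. f (n - l * \<nu>) * p \<nu>) = (\<Sum>\<nu> | l * \<nu> \<le> n. g (n - l * \<nu>) * p \<nu>)"
  shows "f n = g n"
proof (induction n rule: less_induct)
  case (less n)
  let ?I = "{\<nu>. l * \<nu> \<le> n}"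
  have fin: "finite ?I"
    by (rule finite_multiples_le[OF l])
  have split: "(\<Sum>\<nu>\<in>?I. u (n - l * \<nu>) * p \<nu>) = u n + (\<Sum>\<nu>\<in>?I - {0}. u (n - l * \<nu>) * p \<nu>)"
    for u :: "nat \<Rightarrow> nat"
    using fin p by (subst sum.remove[of _ 0]) auto
  have "(\<Sum>\<nu>\<in>?I - {0}. f (n - l * \<nu>) * p \<nu>) = (\<Sum>\<nu>\<in>?I - {0}. g (n - l * \<nu>) * p \<nu>)"
  proof (rule sum.cong[OF refl])
    fix \<nu> assume "\<nu> \<in> ?I - {0}"
    moreover from this have "0 < l * \<nu>"
      using l by simp
    ultimately have "n - l * \<nu> < n"
      by (metis DiffD1 diff_less mem_Collect_eq order_less_le_trans)
    then show "f (n - l * \<nu>) * p \<nu> = g (n - l * \<nu>) * p \<nu>"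
      using less by simp
  qed
  then show ?case
    using eq[of n] by (simp add: split)
qed

section \<open>Two unique decompositions of multisets\<close>

text \<open>
  \<open>Q\<close> collects the quotients by \<open>l\<close> of the elements divisible by \<open>l\<close>, the element 0 included.
\<close>

lemma bij_multiples:
  assumes "l > 0"
  shows "bij_betw (\<lambda>(N, Q). N + image_mset ((*) l) Q)
           ({N. \<forall>k\<in>#N. \<not> l dvd k} \<times> UNIV) (UNIV :: nat multiset set)"
proof (rule bij_betw_byWitness[where f' = "\<lambda>M. (filter_mset (\<lambda>k. \<not> l dvd k) M,
          image_mset (\<lambda>k. k div l) (filter_mset (\<lambda>k. l dvd k) M))"])
  have "filter_mset (\<lambda>k. \<not> l dvd k) N = N" "filter_mset (\<lambda>k. l dvd k) N = {#}"
    if "\<forall>k\<in>#N. \<not> l dvd k" for N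
    using that by (auto simp: filter_mset_eq_conv)
  then show "\<forall>a\<in>{N. \<forall>k\<in>#N. \<not> l dvd k} \<times> UNIV.
      (\<lambda>M. (filter_mset (\<lambda>k. \<not> l dvd k) M,
         image_mset (\<lambda>k. k div l) (filter_mset (\<lambda>k. l dvd k) M)))
      ((\<lambda>(N, Q). N + image_mset ((*) l) Q) a) = a"
    using assms by (auto simp: filter_mset_image_mset multiset.map_comp comp_def)
  have "image_mset ((*) l) (image_mset (\<lambda>k. k div l) (filter_mset (\<lambda>k. l dvd k) M))
      = image_mset (\<lambda>k. k) (filter_mset (\<lambda>k. l dvd k) M)" for M
    unfolding multiset.map_comp comp_def by (rule image_mset_cong) auto
  then show "\<forall>M\<in>UNIV. (\<lambda>(N, Q). N + image_mset ((*) l) Q) (filter_mset (\<lambda>k. \<not> l dvd k) M,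
         image_mset (\<lambda>k. k div l) (filter_mset (\<lambda>k. l dvd k) M)) = M"
    by (simp add: add.commute flip: multiset_partition)
qed auto

text \<open>
  A number is uniquely \<open>c + 2 * q\<close> with \<open>c \<le> 1\<close>; this is applied to every multiplicity.
\<close>

lemma bij_doubling:
  "bij_betw (\<lambda>(N, Q). N + (Q + Q)) ({N. \<forall>k. count N k \<le> 1} \<times> UNIV) (UNIV :: 'a multiset set)"
  unfolding bij_betw_def
proof
  show "inj_on (\<lambda>(N, Q). N + (Q + Q)) ({N. \<forall>k. count N k \<le> 1} \<times> (UNIV :: 'a multiset set))"
  proof (clarsimp simp: inj_on_def)
    fix N Q N' Q' :: "'a multiset"
    assume le: "\<forall>k. count N k \<le> Suc 0" "\<forall>k. count N' k \<le> Suc 0"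
      and eq: "N + (Q + Q) = N' + (Q' + Q')"
    have "count N k = count N' k \<and> count Q k = count Q' k" for k
    proof -
      have "count N k + 2 * count Q k = count N' k + 2 * count Q' k"
        using arg_cong[OF eq, of "\<lambda>M. count M k"] by simp
      moreover have "count N k \<le> 1" "count N' k \<le> 1"
        using le by simp_all
      ultimately show ?thesis
        by presburger
    qed
    then show "N = N' \<and> Q = Q'"
      by (simp add: multiset_eq_iff)
  qed
  show "(\<lambda>(N, Q). N + (Q + Q)) ` ({N. \<forall>k. count N k \<le> 1} \<times> UNIV) = (UNIV :: 'a multiset set)"
  proof (intro subset_antisym subset_UNIV subsetI)
    fix M :: "'a multiset"
    define Q where "Q = Abs_multiset (\<lambda>k. count M k div 2)"
    have "finite {k. 0 < count M k div 2}"
      by (rule finite_subset[of _ "set_mset M"]) (auto simp flip: count_greater_zero_iff)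
    then have Q: "count Q k = count M k div 2" for k
      by (simp add: Q_def count_Abs_multiset)
    have "M = (M - (Q + Q)) + (Q + Q)"
      by (intro multiset_eqI) (simp add: Q)
    moreover have "count (M - (Q + Q)) k \<le> 1" for k
    proof -
      have "count M k - (count M k div 2 + count M k div 2) \<le> 1"
        by presburger
      then show ?thesis
        by (simp add: Q)
    qed
    ultimately show "M \<in> (\<lambda>(N, Q). N + (Q + Q)) ` ({N. \<forall>k. count N k \<le> 1} \<times> UNIV)"
      by (intro image_eqI[of _ _ "(M - (Q + Q), Q)"]) auto
  qed
qed

section \<open>The two counting functions\<close>

lemma R_star_int: "R_star l (int n) = card (part_pairs {N. \<forall>k\<in>#N. \<not> l dvd k} n)"
  by (simp add: R_star_def card_part_pairs)

text \<open>
  The copies \<open>(k, False)\<close> give the multiplicity-free multiset, the copies \<open>(k, True)\<close> the set.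
\<close>

lemma D2_eq_card_part_pairs: "D2 n = card (part_pairs {N. \<forall>k. count N k \<le> 1} n)"
proof -
  let ?f = "\<lambda>(N, S). set_mset N \<times> {False} \<union> S \<times> {True}"
  let ?g = "\<lambda>A. (mset_set {k. (k, False) \<in> A}, {k. (k, True) \<in> A})"
  have fin: "finite {k. (k, b) \<in> A}" if "finite A" for A :: "(nat \<times> bool) set" and b
    using finite_subset[of "{k. (k, b) \<in> A}" "fst ` A"] that by force
  have sum: "(\<Sum>x\<in>B \<times> {False} \<union> S \<times> {True}. fst x) = \<Sum>B + \<Sum>S"
    if "finite B" "finite S" for B S :: "nat set"
  proof -
    have "(\<Sum>x\<in>B \<times> {b}. fst x) = \<Sum>B" for B :: "nat set" and b :: bool
      by (rule sum.reindex_bij_witness[of _ "\<lambda>k. (k, b)" fst]) auto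
    then show ?thesis
      using that by (subst sum.union_disjoint) auto
  qed
  have mset_free: "mset_set (set_mset N) = N" if "\<forall>k. count N k \<le> 1" for N :: "nat multiset"
  proof (rule multiset_eqI)
    fix k
    have "count N k = 0 \<or> count N k = 1"
      using that[rule_format, of k] by linarith
    then show "count (mset_set (set_mset N)) k = count N k"
      by (auto simp: count_mset_set' simp flip: count_greater_zero_iff)
  qed
  have A: "A = {k. (k, False) \<in> A} \<times> {False} \<union> {k. (k, True) \<in> A} \<times> {True}"
    for A :: "(nat \<times> bool) set"
    by auto (metis (full_types))+
  have "bij_betw ?f (part_pairs {N. \<forall>k. count N k \<le> 1} n) (two_copy_distinct_partitions n)"
  proof (rule bij_betw_byWitness[where f' = ?g])
    show "\<forall>a\<in>part_pairs {N. \<forall>k. count N k \<le> 1} n. ?g (?f a) = a"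
      by (auto simp: part_pairs_def mset_free)
    show "\<forall>A\<in>two_copy_distinct_partitions n. ?f (?g A) = A"
    proof
      fix A assume "A \<in> two_copy_distinct_partitions n"
      then have "finite A"
        by (simp add: two_copy_distinct_partitions_def)
      then show "?f (?g A) = A"
        using A[of A, symmetric] fin by simp
    qed
    show "?f ` part_pairs {N. \<forall>k. count N k \<le> 1} n \<subseteq> two_copy_distinct_partitions n"
    proof clarify
      fix N S assume NS: "(N, S) \<in> part_pairs {N. \<forall>k. count N k \<le> 1} n"
      then have "sum_mset N = \<Sum>(set_mset N)"
        using mset_free[of N] by (simp add: part_pairs_def sum_unfold_sum_mset)
      then show "set_mset N \<times> {False} \<union> S \<times> {True} \<in> two_copy_distinct_partitions n"
        using NS by (auto simp: part_pairs_def two_copy_distinct_partitions_def sum intro: gr0I)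
    qed
    show "?g ` two_copy_distinct_partitions n \<subseteq> part_pairs {N. \<forall>k. count N k \<le> 1} n"
    proof clarify
      fix A assume "A \<in> two_copy_distinct_partitions n"
      then have *: "finite A" "\<forall>x\<in>A. 0 < fst x" "(\<Sum>x\<in>A. fst x) = n"
        by (auto simp: two_copy_distinct_partitions_def)
      then have "\<Sum>{k. (k, False) \<in> A} + \<Sum>{k. (k, True) \<in> A} = n"
        using sum[OF fin fin, of A A False True] unfolding A[of A, symmetric] by simp
      with * fin show "?g A \<in> part_pairs {N. \<forall>k. count N k \<le> 1} n"
        by (auto simp: part_pairs_def count_mset_set' sum_unfold_sum_mset)
    qed
  qed
  then show ?thesis
    unfolding D2_def by (rule bij_betw_same_card[symmetric])
qed

lemma R_star_convolution:
  assumes "l > 0"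
  shows "(\<Sum>\<nu> | l * \<nu> \<le> n. R_star l (int (n - l * \<nu>)) * num_partitions \<nu>) = num_overpartitions n"
  unfolding R_star_int
proof (rule convolution_with_partitions[OF assms bij_multiples[OF assms]])
  show "sum_mset (image_mset ((*) l) Q) = l * sum_mset Q" for Q
    by (induction Q) (simp_all add: algebra_simps)
  show "0 \<in># image_mset ((*) l) Q \<longleftrightarrow> 0 \<in># Q" for Q
    using assms by auto
qed

lemma D2_convolution:
  "(\<Sum>\<nu> | 2 * \<nu> \<le> n. D2 (n - 2 * \<nu>) * num_partitions \<nu>) = num_overpartitions n"
  unfolding D2_eq_card_part_pairs
  by (rule convolution_with_partitions[OF _ bij_doubling]) auto

theorem theorem3p8:
  fixes n :: nat
  shows "(\<forall>l::nat. l > 0 \<longrightarrow>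
            R_star l (int n)
              + (\<Sum>\<^sub>\<infinity>\<nu>\<in>{1::nat..}. R_star l (int n - int l * int \<nu>) * num_partitions \<nu>)
            = num_overpartitions n)
         \<and> R_star 2 (int n) = D2 n"
proof (intro conjI allI impI)
  fix l :: nat assume l: "l > 0"
  let ?I = "{\<nu>. l * \<nu> \<le> n}"
  let ?t = "\<lambda>\<nu>. R_star l (int n - int l * int \<nu>) * num_partitions \<nu>"
  have fin: "finite ?I"
    by (rule finite_multiples_le[OF l])
  have vanish: "?t \<nu> = 0" if "\<nu> \<notin> ?I" for \<nu>
  proof -
    have "int n < int l * int \<nu>"
      using that by (simp flip: of_nat_mult)
    then show ?thesis
      by (simp add: R_star_def)
  qed
  have "infsum ?t {1..} = infsum ?t (?I - {0})"
  proof (rule infsum_cong_neutral)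
    show "?t \<nu> = 0" if "\<nu> \<in> {1..} - (?I - {0})" for \<nu>
      using that by (intro vanish) auto
  qed auto
  also have "\<dots> = sum ?t (?I - {0})"
    using fin by simp
  finally have "R_star l (int n) + infsum ?t {1..} = sum ?t ?I"
    using fin by (subst sum.remove[of _ 0]) (auto simp: num_partitions_0)
  also have "\<dots> = (\<Sum>\<nu>\<in>?I. R_star l (int (n - l * \<nu>)) * num_partitions \<nu>)"
    by (rule sum.cong) (auto simp: of_nat_diff)
  also have "\<dots> = num_overpartitions n"
    by (rule R_star_convolution[OF l])
  finally show "R_star l (int n) + infsum ?t {1..} = num_overpartitions n" .
next
  show "R_star 2 (int n) = D2 n"
    by (rule convolution_cancel[of 2 num_partitions "\<lambda>m. R_star 2 (int m)" D2])
      (simp_all only: num_partitions_0 R_star_convolution D2_convolution zero_less_numeral)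
qed

end
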